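(* Let $H_1,H_2$ be real Hilbert spaces, $C:H_1\to H_2$ a bounded linear mapping with adjoint $C^T:H_2\to H_1$, and $\mathcal{M}:H_2\rightrightarrows H_2$ a maximal monotone operator. Let $\lambda>0$ and $y\in H_1$ be given. Then $J_{\lambda C^T\mathcal{M}C}\,y$ can be expressed as $y-\lambda C^Tv$, where $v$ is the fixed point of the operator $\mathcal{N}:H_2\to H_2$ defined by $$v\mapsto\mathcal{N}(v):=\mathcal{M}_{\frac1\mu}\Big(Cy+\big(\tfrac1\mu I-\lambda CC^T\big)v\Big),$$ for any $\mu>0$, where $\mathcal{M}_{\frac1\mu}$ denotes the Yosida approximation of $\mathcal{M}$ with index $\frac1\mu$. Furthermore, if $\lambda\mu\le\frac{2}{\|C\|^2}$, then $\|I-\lambda\mu CC^T\|\le1$, thereby ensuring that $\mathcal{N}$ is nonexpansive.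
   Context: The composite $C^T\mathcal{M}C:H_1\rightrightarrows H_1$ is $C^T\mathcal{M}C(x)=\{C^Tu^*: u^*\in\mathcal{M}(Cx)\}$. The resolvent of an operator $\mathcal{A}$ is $J_{\mathcal{A}}=(I+\mathcal{A})^{-1}$, so $x=J_{\lambda C^T\mathcal{M}C}\,y$ means that $x\in H_1$ satisfies $y\in x+\lambda C^T\mathcal{M}Cx$. The Yosida approximation of $\mathcal{M}$ of index $\alpha>0$ is the single-valued map $\mathcal{M}_\alpha=\frac1\alpha(I-J_{\alpha\mathcal{M}})=(\alpha I+\mathcal{M}^{-1})^{-1}$. Nonexpansive means Lipschitz with constant $1$. *)

theory Defs
  imports "HOL-Analysis.Analysis"
begin

text \<open>
  A set-valued operator is a function into sets. A real Hilbert space is a type of sort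
  \<open>{real_inner, banach}\<close>.
\<close>

definition monotone_operator :: "('a::real_inner \<Rightarrow> 'a set) \<Rightarrow> bool" where
  "monotone_operator A \<longleftrightarrow>
     (\<forall>x y. \<forall>u\<in>A x. \<forall>v\<in>A y. 0 \<le> (x - y) \<bullet> (u - v))"

definition maximal_monotone :: "('a::real_inner \<Rightarrow> 'a set) \<Rightarrow> bool" where
  "maximal_monotone A \<longleftrightarrow>
     monotone_operator A \<and>
     (\<forall>B. monotone_operator B \<and> (\<forall>x. A x \<subseteq> B x) \<longrightarrow> B = A)"

definition scale_operator :: "real \<Rightarrow> ('a \<Rightarrow> 'b::real_vector set) \<Rightarrow> 'a \<Rightarrow> 'b set" where
  "scale_operator c A x = (\<lambda>u. c *\<^sub>R u) ` A x"

definition inverse_operator :: "('a \<Rightarrow> 'b set) \<Rightarrow> 'b \<Rightarrow> 'a set" where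
  "inverse_operator A y = {x. y \<in> A x}"

definition resolvent :: "('a::real_vector \<Rightarrow> 'a set) \<Rightarrow> 'a \<Rightarrow> 'a set" where
  "resolvent A = inverse_operator (\<lambda>x. (\<lambda>u. x + u) ` A x)"

text \<open>
  For a maximal monotone operator on a Hilbert space and a positive index, the resolvent below
  is single-valued and everywhere defined (Minty), so the description is proper.
\<close>

definition yosida :: "real \<Rightarrow> ('a::real_vector \<Rightarrow> 'a set) \<Rightarrow> 'a \<Rightarrow> 'a" where
  "yosida \<alpha> A x = (1 / \<alpha>) *\<^sub>R (x - (THE z. z \<in> resolvent (scale_operator \<alpha> A) x))"

text \<open>
  Here \<open>adjoint\<close> is the library's Hilbert-choice adjoint; for a bounded linear map between
  Hilbert spaces it satisfies the defining identity by the Riesz representation theorem.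
\<close>

definition composite_operator ::
    "('a::real_inner \<Rightarrow> 'b::real_inner) \<Rightarrow> ('b \<Rightarrow> 'b set) \<Rightarrow> 'a \<Rightarrow> 'a set" where
  "composite_operator C M x = adjoint C ` M (C x)"

definition fixpoint_map ::
    "('a::real_inner \<Rightarrow> 'b::real_inner) \<Rightarrow> ('b \<Rightarrow> 'b set) \<Rightarrow> real \<Rightarrow> real \<Rightarrow> 'a \<Rightarrow> 'b \<Rightarrow> 'b" where
  "fixpoint_map C M lam mu y v =
     yosida (1 / mu) M (C y + ((1 / mu) *\<^sub>R v - lam *\<^sub>R C (adjoint C v)))"

end

theory Submission imports Defs begin

text \<open>
  The inclusion \<open>y \<in> x + \<lambda> C\<^sup>T M C x\<close> says that \<open>x = y - \<lambda> C\<^sup>T v\<close> for some \<open>v \<in> M (C x)\<close>. Eliminating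
  \<open>x\<close> leaves \<open>v \<in> M (C (y - \<lambda> C\<^sup>T v))\<close>, an inclusion in \<open>v\<close> alone. On the other side, the Yosida
  approximation of index \<open>\<alpha>\<close> is the inverse of \<open>\<alpha> I + M\<^sup>-\<^sup>1\<close>: its value at \<open>w\<close> is \<open>v\<close> exactly
  when \<open>v \<in> M (w - \<alpha> v)\<close> (\<open>yosida_eq_iff\<close>). With \<open>\<alpha> = 1/\<mu>\<close> and \<open>w = C y + (v/\<mu> - \<lambda> C C\<^sup>T v)\<close> the
  term \<open>v/\<mu>\<close> cancels, and \<open>v = N v\<close> is the same inclusion (\<open>fixpoint_map_fixed_iff\<close>). A resolvent
  value is unique because \<open>C\<^sup>T M C\<close> is monotone, so every fixed point yields the same \<open>x\<close>.

  For nonexpansiveness, \<open>M\<^bsub>1/\<mu>\<^esub>\<close> is \<open>\<mu>\<close>-Lipschitz by monotonicity, and its argument depends on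
  \<open>v\<close> through \<open>(1/\<mu>) (I - \<lambda>\<mu> C C\<^sup>T)\<close>, which is \<open>1/\<mu>\<close> times a map of norm at most 1 as soon as
  \<open>\<lambda>\<mu> \<parallel>C\<parallel>\<^sup>2 \<le> 2\<close>.

  Two existence theorems stand behind this: Riesz representation, which makes \<open>C\<^sup>T\<close> an actual
  adjoint, and Minty's theorem, which makes the resolvent of \<open>M\<close> everywhere defined. Both are
  derived from one fact, that \<open>t + \<parallel>p\<parallel>\<^sup>2/2\<close> attains its minimum over a closed convex set of pairs
  \<open>(p, t)\<close> on which it is bounded below (\<open>proximal_point_exists\<close>). The set is the epigraph of the
  functional \<open>-f\<close> for Riesz, and that of the Fitzpatrick function of \<open>M\<close> for Minty.
\<close>

section \<open>Minimising a quadratic perturbation over a closed convex set\<close>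

lemma norm_midpoint_sq:
  fixes p q :: "'h::real_inner"
  shows "(norm ((1/2) *\<^sub>R p + (1/2) *\<^sub>R q))\<^sup>2
           = (norm p)\<^sup>2 / 2 + (norm q)\<^sup>2 / 2 - (norm (p - q))\<^sup>2 / 4"
  by (simp add: power2_norm_eq_inner inner_simps inner_commute field_simps)

text \<open>
  Think of \<open>E\<close> as the epigraph of a lower semicontinuous convex function \<open>F\<close>. Then \<open>(p0, t0)\<close> is the
  minimiser of \<open>F + \<parallel>\<cdot>\<parallel>\<^sup>2/2\<close>, and the inequality is the optimality condition \<open>-p0 \<in> \<partial>F(p0)\<close>. Strong
  convexity, in the form of the parallelogram law, makes a minimising sequence Cauchy, which
  replaces any compactness. Working with a set of pairs avoids functions with value \<open>\<infinity>\<close>.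
\<close>

lemma proximal_point_exists:
  fixes E :: "('h::{real_inner,banach} \<times> real) set"
  assumes "closed E" and "convex E" and "E \<noteq> {}"
    and bounded_below: "\<And>p t. (p, t) \<in> E \<Longrightarrow> b \<le> t + (norm p)\<^sup>2 / 2"
  shows "\<exists>p0 t0. (p0, t0) \<in> E \<and> (\<forall>p t. (p, t) \<in> E \<longrightarrow> t0 - p0 \<bullet> (p - p0) \<le> t)"
proof -
  define \<phi> where "\<phi> q = snd q + (norm (fst q))\<^sup>2 / 2" for q :: "'h \<times> real"
  define m where "m = Inf (\<phi> ` E)"
  have bdd: "bdd_below (\<phi> ` E)"
    using bounded_below unfolding \<phi>_def bdd_below_def by fastforce
  have m_le: "m \<le> \<phi> q" if "q \<in> E" for q
    unfolding m_def using bdd that by (simp add: cInf_lower)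
  have "\<exists>q\<in>E. \<phi> q < m + 1 / real (Suc n)" for n
  proof -
    have "Inf (\<phi> ` E) < m + 1 / real (Suc n)"
      by (simp add: m_def)
    then show ?thesis
      using cInf_less_iff[of "\<phi> ` E"] bdd \<open>E \<noteq> {}\<close> by auto
  qed
  then obtain q where q_E: "q n \<in> E" and q_less: "\<phi> (q n) < m + 1 / real (Suc n)" for n
    by metis
  have dist_le: "(dist (fst (q i)) (fst (q j)))\<^sup>2 \<le> 4 * (1 / real (Suc i) + 1 / real (Suc j))" for i j
  proof -
    have "(1/2) *\<^sub>R q i + (1/2) *\<^sub>R q j \<in> E"
      using \<open>convex E\<close> q_E by (intro convexD) auto
    then have "m \<le> \<phi> ((1/2) *\<^sub>R q i + (1/2) *\<^sub>R q j)"
      by (rule m_le)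
    also have "\<dots> = \<phi> (q i) / 2 + \<phi> (q j) / 2 - (norm (fst (q i) - fst (q j)))\<^sup>2 / 8"
      unfolding \<phi>_def by (simp add: norm_midpoint_sq field_simps)
    finally show ?thesis
      using q_less[of i] q_less[of j] by (simp add: dist_norm)
  qed
  have "Cauchy (\<lambda>n. fst (q n))"
  proof (rule metric_CauchyI)
    fix e :: real assume "0 < e"
    then obtain N where N: "1 / real (Suc N) < e\<^sup>2 / 8"
      using nat_approx_posE[of "e\<^sup>2 / 8"] by auto
    have "dist (fst (q i)) (fst (q j)) < e" if "N \<le> i" "N \<le> j" for i j
    proof -
      have "1 / real (Suc i) + 1 / real (Suc j) < e\<^sup>2 / 8 + e\<^sup>2 / 8"
        using that by (intro add_strict_mono order_le_less_trans[OF _ N]) (simp_all add: frac_le)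
      then have "(dist (fst (q i)) (fst (q j)))\<^sup>2 < e\<^sup>2"
        using dist_le[of i j] by (simp only: distrib_left)
      then show ?thesis
        by (rule power2_less_imp_less) (use \<open>0 < e\<close> in simp)
    qed
    then show "\<exists>N. \<forall>i\<ge>N. \<forall>j\<ge>N. dist (fst (q i)) (fst (q j)) < e"
      by blast
  qed
  then obtain p0 where p0: "(\<lambda>n. fst (q n)) \<longlonglongrightarrow> p0"
    using Cauchy_convergent convergent_def by blast
  \<comment> \<open>Forced by \<open>t0 + \<parallel>p0\<parallel>\<^sup>2/2 = m\<close>.\<close>
  define t0 where "t0 = m - (norm p0)\<^sup>2 / 2"
  have "(\<lambda>n. \<phi> (q n)) \<longlonglongrightarrow> m"
  proof (rule tendsto_sandwich)
    show "\<forall>\<^sub>F n in sequentially. m \<le> \<phi> (q n)"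
      using m_le q_E by simp
    show "\<forall>\<^sub>F n in sequentially. \<phi> (q n) \<le> m + 1 / real (Suc n)"
      by (intro always_eventually allI less_imp_le q_less)
    show "(\<lambda>n. m) \<longlonglongrightarrow> m"
      by simp
    show "(\<lambda>n. m + 1 / real (Suc n)) \<longlonglongrightarrow> m"
      using LIMSEQ_inverse_real_of_nat_add[of m] by (simp add: inverse_eq_divide)
  qed
  then have "(\<lambda>n. \<phi> (q n) - (norm (fst (q n)))\<^sup>2 / 2) \<longlonglongrightarrow> m - (norm p0)\<^sup>2 / 2"
    by (intro tendsto_intros p0) simp_all
  then have "(\<lambda>n. snd (q n)) \<longlonglongrightarrow> t0"
    by (simp add: \<phi>_def t0_def)
  with p0 have "(\<lambda>n. (fst (q n), snd (q n))) \<longlonglongrightarrow> (p0, t0)"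
    by (rule tendsto_Pair)
  then have E0: "(p0, t0) \<in> E"
    using \<open>closed E\<close> q_E by (auto simp: closed_sequential_limits)
  have "t0 - p0 \<bullet> (p - p0) \<le> t" if "(p, t) \<in> E" for p t
  proof -
    \<comment> \<open>\<open>g s\<close> is the difference quotient of \<open>\<phi>\<close> from \<open>(p0, t0)\<close> towards \<open>(p, t)\<close>; the claim is \<open>0 \<le> g 0\<close>.\<close>
    define g where "g s = (t - t0) + p0 \<bullet> (p - p0) + s * (norm (p - p0))\<^sup>2 / 2" for s
    have "0 \<le> g s" if s: "0 < s" "s < 1" for s
    proof -
      have "(1 - s) *\<^sub>R (p0, t0) + s *\<^sub>R (p, t) \<in> E"
        using \<open>convex E\<close> E0 \<open>(p, t) \<in> E\<close> s by (intro convexD) auto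
      then have "m \<le> \<phi> ((1 - s) *\<^sub>R (p0, t0) + s *\<^sub>R (p, t))"
        by (rule m_le)
      also have "(1 - s) *\<^sub>R (p0, t0) + s *\<^sub>R (p, t) = (p0 + s *\<^sub>R (p - p0), t0 + s * (t - t0))"
        by (simp add: algebra_simps)
      also have "\<phi> \<dots> = m + s * g s"
        unfolding \<phi>_def g_def t0_def
        by (simp add: power2_norm_eq_inner inner_simps inner_commute field_simps)
      finally show ?thesis
        using s by (simp add: zero_le_mult_iff)
    qed
    then have "\<forall>\<^sub>F s in at_right 0. 0 \<le> g s"
      unfolding eventually_at_right_field using zero_less_one by blast
    moreover have "(g \<longlongrightarrow> g 0) (at_right 0)"
      unfolding g_def by (intro tendsto_intros) simp_all
    ultimately have "0 \<le> g 0"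
      by (intro tendsto_lowerbound) auto
    then show ?thesis by (simp add: g_def)
  qed
  with E0 show ?thesis by blast
qed

section \<open>The adjoint of a bounded linear map\<close>

text \<open>
  Minimise \<open>\<parallel>p\<parallel>\<^sup>2/2 - f p\<close>. At the minimiser \<open>p0\<close> optimality reads \<open>f h \<le> \<langle>p0, h\<rangle>\<close> for all \<open>h\<close>, and
  replacing \<open>h\<close> by \<open>-h\<close> gives equality.
\<close>

lemma riesz_representation:
  fixes f :: "'h::{real_inner,banach} \<Rightarrow> real"
  assumes "bounded_linear f"
  obtains z where "\<And>x. f x = x \<bullet> z"
proof -
  interpret f: bounded_linear f by fact
  define E where "E = {q :: 'h \<times> real. - f (fst q) \<le> snd q}"
  have "closed E"
    unfolding E_def by (intro closed_Collect_le continuous_intros f.continuous_on)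
  moreover have "convex E"
    unfolding convex_def E_def
  proof (clarsimp simp: f.add f.scaleR)
    fix a a' :: 'h and t t' u v :: real
    assume *: "- f a \<le> t" "- f a' \<le> t'" "0 \<le> u" "0 \<le> v"
    show "- (u * f a) - v * f a' \<le> u * t + v * t'"
      using mult_left_mono[OF *(1,3)] mult_left_mono[OF *(2,4)] by simp
  qed
  moreover have "E \<noteq> {}"
    by (auto simp: E_def intro!: exI[of _ "(0, 0)"])
  moreover have "- (onorm f)\<^sup>2 / 2 \<le> t + (norm p)\<^sup>2 / 2" if "(p, t) \<in> E" for p t
  proof -
    have "\<bar>f p\<bar> \<le> onorm f * norm p"
      using onorm[OF assms, of p] by simp
    moreover have "0 \<le> (norm p - onorm f)\<^sup>2" by simp
    ultimately show ?thesis
      using that by (simp add: E_def power2_diff algebra_simps)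
  qed
  ultimately have "\<exists>p0 t0. (p0, t0) \<in> E \<and> (\<forall>p t. (p, t) \<in> E \<longrightarrow> t0 - p0 \<bullet> (p - p0) \<le> t)"
    by (rule proximal_point_exists)
  then obtain p0 t0 where "(p0, t0) \<in> E"
    and *: "\<And>p t. (p, t) \<in> E \<Longrightarrow> t0 - p0 \<bullet> (p - p0) \<le> t"
    by blast
  have le: "f h \<le> p0 \<bullet> h" for h
  proof -
    have "(p0 + h, - f (p0 + h)) \<in> E"
      by (simp add: E_def)
    from *[OF this] \<open>(p0, t0) \<in> E\<close> show ?thesis
      by (simp add: E_def f.add)
  qed
  have "f x = x \<bullet> p0" for x
    using le[of x] le[of "- x"] by (simp add: f.neg inner_commute)
  then show thesis by (rule that)
qed

lemma inner_adjoint_eq: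
  fixes C :: "'a::{real_inner,banach} \<Rightarrow> 'b::real_inner"
  assumes "bounded_linear C"
  shows "x \<bullet> adjoint C w = C x \<bullet> w"
proof -
  have "\<exists>z. \<forall>x. C x \<bullet> w = x \<bullet> z" for w
    using riesz_representation[OF bounded_linear_compose[OF bounded_linear_inner_left assms]]
    by metis
  then have "\<exists>D. \<forall>x w. C x \<bullet> w = x \<bullet> D w"
    by metis
  then have "\<forall>x w. C x \<bullet> w = x \<bullet> adjoint C w"
    unfolding adjoint_def by (rule someI_ex)
  then show ?thesis by simp
qed

lemma linear_adjoint:
  fixes C :: "'a::{real_inner,banach} \<Rightarrow> 'b::real_inner"
  assumes "bounded_linear C"
  shows "linear (adjoint C)"
proof (rule linearI)
  show "adjoint C (v + w) = adjoint C v + adjoint C w" for v w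
    by (rule iffD1[OF vector_eq_ldot]) (simp add: inner_simps inner_adjoint_eq[OF assms])
  show "adjoint C (c *\<^sub>R v) = c *\<^sub>R adjoint C v" for c v
    by (rule iffD1[OF vector_eq_ldot]) (simp add: inner_simps inner_adjoint_eq[OF assms])
qed

text \<open>
  Expanding the square gives
  \<open>\<parallel>w\<parallel>\<^sup>2 - 2 \<tau> \<parallel>C\<^sup>T w\<parallel>\<^sup>2 + \<tau>\<^sup>2 \<parallel>C C\<^sup>T w\<parallel>\<^sup>2 \<le> \<parallel>w\<parallel>\<^sup>2 - \<tau> (2 - \<tau> \<parallel>C\<parallel>\<^sup>2) \<parallel>C\<^sup>T w\<parallel>\<^sup>2\<close>.
\<close>

lemma norm_minus_normal_operator_le:
  fixes C :: "'a::{real_inner,banach} \<Rightarrow> 'b::real_inner"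
  assumes C: "bounded_linear C" and "0 \<le> \<tau>" and small: "\<tau> * (onorm C)\<^sup>2 \<le> 2"
  shows "norm (w - \<tau> *\<^sub>R C (adjoint C w)) \<le> norm w"
proof -
  define a where "a = adjoint C w"
  have "norm (C a) \<le> onorm C * norm a"
    by (rule onorm[OF C])
  then have "(norm (C a))\<^sup>2 \<le> (onorm C * norm a)\<^sup>2"
    by (simp add: power_mono)
  then have "\<tau> * (norm (C a))\<^sup>2 \<le> \<tau> * (onorm C)\<^sup>2 * (norm a)\<^sup>2"
    using \<open>0 \<le> \<tau>\<close> by (simp add: power_mult_distrib mult.assoc mult_left_mono)
  also have "\<dots> \<le> 2 * (norm a)\<^sup>2"
    using small by (simp add: mult_right_mono)
  finally have "\<tau> * (\<tau> * (norm (C a))\<^sup>2) \<le> \<tau> * (2 * (norm a)\<^sup>2)"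
    using \<open>0 \<le> \<tau>\<close> by (rule mult_left_mono)
  moreover have "(norm (w - \<tau> *\<^sub>R C a))\<^sup>2
      = (norm w)\<^sup>2 - \<tau> * (2 * (norm a)\<^sup>2) + \<tau> * (\<tau> * (norm (C a))\<^sup>2)"
    using inner_adjoint_eq[OF C, of a w]
    by (simp add: power2_norm_eq_inner inner_simps inner_commute a_def[symmetric] algebra_simps)
  ultimately have "(norm (w - \<tau> *\<^sub>R C a))\<^sup>2 \<le> (norm w)\<^sup>2"
    by linarith
  then show ?thesis
    unfolding a_def by (rule power2_le_imp_le) simp
qed

section \<open>Resolvents of maximal monotone operators\<close>

lemma monotone_operatorD:
  assumes "monotone_operator A" and "u \<in> A x" and "v \<in> A y"
  shows "0 \<le> (x - y) \<bullet> (u - v)"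
  using assms by (auto simp: monotone_operator_def)

text \<open>
  Maximality in pointwise form: a pair monotonically related to the whole graph could be added to
  it, so it already belongs to it.
\<close>

lemma maximal_monotone_memI:
  assumes "maximal_monotone A"
    and related: "\<And>s v. v \<in> A s \<Longrightarrow> 0 \<le> (x - s) \<bullet> (u - v)"
  shows "u \<in> A x"
proof -
  define B where "B s = (if s = x then insert u (A s) else A s)" for s
  have mono: "monotone_operator A" using assms(1) by (simp add: maximal_monotone_def)
  have related': "0 \<le> (s - x) \<bullet> (v - u)" if "v \<in> A s" for s v
    using related[OF that] inner_minus_left[of "x - s" "u - v"] inner_minus_right[of "s - x" "u - v"] by simp
  have "monotone_operator B"
    unfolding monotone_operator_def B_def
    using related related' monotone_operatorD[OF mono] by (auto split: if_splits)
  moreover have "\<forall>s. A s \<subseteq> B s" by (auto simp: B_def)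
  ultimately have "B = A" using assms(1) by (auto simp: maximal_monotone_def)
  then show ?thesis by (metis B_def insertI1)
qed

text \<open>
  Minty's theorem at the origin: \<open>0 \<in> x + A x\<close> has a solution, for the operator \<open>A\<close> with graph \<open>G\<close>.
  The proof uses the Fitzpatrick function
  \<open>F (x, u) = sup {\<langle>x, v\<rangle> + \<langle>s, u\<rangle> - \<langle>s, v\<rangle> | (s, v) \<in> G}\<close>,
  which satisfies \<open>F (x, u) \<ge> \<langle>x, u\<rangle>\<close> by maximality, with equality on \<open>G\<close> by monotonicity. Hence
  \<open>F + \<parallel>\<cdot>\<parallel>\<^sup>2/2 \<ge> \<parallel>x + u\<parallel>\<^sup>2/2 \<ge> 0\<close>, and a minimiser \<open>(x0, u0)\<close> exists. Its optimality condition,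
  tested on \<open>G\<close>, says that \<open>(-u0, -x0)\<close> is monotonically related to \<open>G\<close> with the margin
  \<open>\<parallel>x0 + u0\<parallel>\<^sup>2\<close>. So \<open>(-u0, -x0)\<close> lies in \<open>G\<close>, and testing on this very pair forces \<open>u0 = -x0\<close>.
\<close>

lemma maximal_monotone_neg_mem:
  fixes G :: "('b::{real_inner,banach} \<times> 'b) set"
  assumes mono: "\<And>x u s v. (x, u) \<in> G \<Longrightarrow> (s, v) \<in> G \<Longrightarrow> 0 \<le> (x - s) \<bullet> (u - v)"
    and maximal: "\<And>x u. (\<And>s v. (s, v) \<in> G \<Longrightarrow> 0 \<le> (x - s) \<bullet> (u - v)) \<Longrightarrow> (x, u) \<in> G"
  obtains x where "(x, - x) \<in> G"
proof -
  \<comment> \<open>The epigraph of the Fitzpatrick function, as an intersection of half-spaces.\<close>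
  define E where "E = (\<Inter>(s, v)\<in>G. {q. ((v, s), - 1 :: real) \<bullet> q \<le> s \<bullet> v})"
  have E_iff: "((x, u), t) \<in> E \<longleftrightarrow> (\<forall>(s, v)\<in>G. x \<bullet> v + s \<bullet> u - s \<bullet> v \<le> t)" for x u t
    by (auto simp: E_def inner_commute algebra_simps)
  have graph_E: "((x, u), x \<bullet> u) \<in> E" if "(x, u) \<in> G" for x u
    unfolding E_iff
  proof clarify
    fix s v assume "(s, v) \<in> G"
    from mono[OF that this] show "x \<bullet> v + s \<bullet> u - s \<bullet> v \<le> x \<bullet> u"
      by (simp add: inner_simps)
  qed
  have above: "x \<bullet> u \<le> t" if "((x, u), t) \<in> E" for x u t
  proof (cases "(x, u) \<in> G")
    case True
    then show ?thesis using that unfolding E_iff by fastforce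
  next
    case False
    then obtain s v where "(s, v) \<in> G" "(x - s) \<bullet> (u - v) < 0"
      using maximal by (meson not_le)
    then show ?thesis using that unfolding E_iff by (fastforce simp: inner_simps)
  qed
  have "closed E"
    unfolding E_def by (auto intro!: closed_INT closed_halfspace_le)
  moreover have "convex E"
    unfolding E_def by (auto intro!: convex_INT convex_halfspace_le)
  moreover have "E \<noteq> {}"
    using graph_E maximal by (metis empty_iff ex_in_conv)
  moreover have "0 \<le> t + (norm p)\<^sup>2 / 2" if "(p, t) \<in> E" for p t
  proof -
    obtain x u where p: "p = (x, u)" by fastforce
    have "0 \<le> (norm (x + u))\<^sup>2" by simp
    also have "\<dots> = 2 * (x \<bullet> u) + (norm p)\<^sup>2"
      by (simp add: p power2_norm_eq_inner inner_simps inner_commute)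
    finally show ?thesis using above[of x u t] that p by simp
  qed
  ultimately have "\<exists>p0 t0. (p0, t0) \<in> E \<and> (\<forall>p t. (p, t) \<in> E \<longrightarrow> t0 - p0 \<bullet> (p - p0) \<le> t)"
    by (rule proximal_point_exists)
  then obtain p0 t0 where E0: "(p0, t0) \<in> E"
    and *: "\<And>p t. (p, t) \<in> E \<Longrightarrow> t0 - p0 \<bullet> (p - p0) \<le> t"
    by blast
  obtain x0 u0 where p0: "p0 = (x0, u0)" by fastforce
  have key: "(norm (x0 + u0))\<^sup>2 \<le> (- u0 - s) \<bullet> (- x0 - v)" if "(s, v) \<in> G" for s v
    using *[OF graph_E[OF that]] above[of x0 u0 t0] E0
    by (simp add: p0 power2_norm_eq_inner inner_simps inner_commute)
  have "(- u0, - x0) \<in> G"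
    by (rule maximal) (use key in \<open>meson order_trans zero_le_power2\<close>)
  moreover from key[OF this] have "u0 = - x0"
    by (simp add: add_eq_0_iff)
  ultimately show thesis using that by auto
qed

lemma mem_resolvent_scale_iff:
  "z \<in> resolvent (scale_operator c A) x \<longleftrightarrow> (\<exists>u\<in>A z. x = z + c *\<^sub>R u)"
  by (auto simp: resolvent_def inverse_operator_def scale_operator_def)

text \<open>
  The general inclusion \<open>x \<in> z + \<alpha> A z\<close> is the case at the origin of the operator
  \<open>z \<mapsto> \<alpha> A z - x\<close>, whose graph \<open>G\<close> inherits monotonicity and maximality from \<open>A\<close>.
\<close>

lemma minty:
  fixes A :: "'b::{real_inner,banach} \<Rightarrow> 'b set"
  assumes A: "maximal_monotone A" and "0 < \<alpha>"
  shows "\<exists>z. z \<in> resolvent (scale_operator \<alpha> A) x"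
proof -
  define G where "G = {(z, w). (1 / \<alpha>) *\<^sub>R (x + w) \<in> A z}"
  have G_iff: "(z, \<alpha> *\<^sub>R u - x) \<in> G \<longleftrightarrow> u \<in> A z" for z u
    using \<open>0 < \<alpha>\<close> by (simp add: G_def)
  have mono: "monotone_operator A" using A by (simp add: maximal_monotone_def)
  obtain z where "(z, - z) \<in> G"
  proof (rule maximal_monotone_neg_mem[of G])
    show "0 \<le> (z - s) \<bullet> (w - v)" if "(z, w) \<in> G" "(s, v) \<in> G" for z w s v
    proof -
      have "0 \<le> (z - s) \<bullet> ((1 / \<alpha>) *\<^sub>R (x + w) - (1 / \<alpha>) *\<^sub>R (x + v))"
        using that by (intro monotone_operatorD[OF mono]) (auto simp: G_def)
      also have "\<dots> = (1 / \<alpha>) * ((z - s) \<bullet> (w - v))"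
        by (simp add: scaleR_diff_right[symmetric])
      finally show ?thesis using \<open>0 < \<alpha>\<close> by (simp add: zero_le_divide_iff)
    qed
    show "(z, w) \<in> G" if rel: "\<And>s v. (s, v) \<in> G \<Longrightarrow> 0 \<le> (z - s) \<bullet> (w - v)" for z w
    proof -
      have "(1 / \<alpha>) *\<^sub>R (x + w) \<in> A z"
      proof (rule maximal_monotone_memI[OF A])
        fix s u assume "u \<in> A s"
        then have "0 \<le> (z - s) \<bullet> (w - (\<alpha> *\<^sub>R u - x))"
          by (intro rel) (simp add: G_iff)
        moreover have "(1 / \<alpha>) *\<^sub>R (x + w) - u = (1 / \<alpha>) *\<^sub>R (w - (\<alpha> *\<^sub>R u - x))"
          using \<open>0 < \<alpha>\<close> by (simp add: algebra_simps)
        ultimately show "0 \<le> (z - s) \<bullet> ((1 / \<alpha>) *\<^sub>R (x + w) - u)"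
          using \<open>0 < \<alpha>\<close> by simp
      qed
      then show ?thesis by (simp add: G_def)
    qed
  qed
  then have "(1 / \<alpha>) *\<^sub>R (x - z) \<in> A z" by (simp add: G_def)
  moreover have "x = z + \<alpha> *\<^sub>R (1 / \<alpha>) *\<^sub>R (x - z)"
    using \<open>0 < \<alpha>\<close> by simp
  ultimately show ?thesis
    unfolding mem_resolvent_scale_iff by blast
qed

lemma resolvent_scale_unique:
  assumes "monotone_operator A" and "0 \<le> c"
    and "z \<in> resolvent (scale_operator c A) x" and "z' \<in> resolvent (scale_operator c A) x"
  shows "z = z'"
proof -
  obtain u u' where u: "u \<in> A z" "x = z + c *\<^sub>R u" and u': "u' \<in> A z'" "x = z' + c *\<^sub>R u'"
    using assms(3,4) unfolding mem_resolvent_scale_iff by blast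
  have "z - z' = - c *\<^sub>R (u - u')"
    using u(2) u'(2) by (simp add: algebra_simps)
  then have "(norm (z - z'))\<^sup>2 = - (c * ((z - z') \<bullet> (u - u')))"
    unfolding power2_norm_eq_inner by (metis inner_scaleR_right mult_minus_left)
  also have "\<dots> \<le> 0"
    using monotone_operatorD[OF assms(1) u(1) u'(1)] \<open>0 \<le> c\<close> by simp
  finally show ?thesis by simp
qed

text \<open>
  This is the identity \<open>A\<^sub>\<alpha> = (\<alpha> I + A\<^sup>-\<^sup>1)\<^sup>-\<^sup>1\<close>, and the only way in which the Yosida approximation
  enters below. Minty's theorem is what makes the definite description in its definition proper.
\<close>

lemma yosida_eq_iff:
  fixes A :: "'b::{real_inner,banach} \<Rightarrow> 'b set"
  assumes A: "maximal_monotone A" and "0 < \<alpha>"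
  shows "yosida \<alpha> A x = v \<longleftrightarrow> v \<in> A (x - \<alpha> *\<^sub>R v)"
proof -
  define z where "z = (THE z. z \<in> resolvent (scale_operator \<alpha> A) x)"
  have mono: "monotone_operator A" using A by (simp add: maximal_monotone_def)
  have ex1: "\<exists>!z. z \<in> resolvent (scale_operator \<alpha> A) x"
    using minty[OF assms] resolvent_scale_unique[OF mono] \<open>0 < \<alpha>\<close> by (metis less_imp_le)
  then have "z \<in> resolvent (scale_operator \<alpha> A) x"
    unfolding z_def by (rule theI')
  then have "z' = z \<longleftrightarrow> z' \<in> resolvent (scale_operator \<alpha> A) x" for z'
    using ex1 by blast
  then have "x - \<alpha> *\<^sub>R v = z \<longleftrightarrow> (\<exists>u\<in>A (x - \<alpha> *\<^sub>R v). x = x - \<alpha> *\<^sub>R v + \<alpha> *\<^sub>R u)"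
    by (simp add: mem_resolvent_scale_iff)
  also have "\<dots> \<longleftrightarrow> v \<in> A (x - \<alpha> *\<^sub>R v)"
    using \<open>0 < \<alpha>\<close> by (auto simp: algebra_simps)
  also have "x - \<alpha> *\<^sub>R v = z \<longleftrightarrow> yosida \<alpha> A x = v"
  proof -
    have "(1 / \<alpha>) *\<^sub>R (x - z) = v \<longleftrightarrow> x - z = \<alpha> *\<^sub>R v"
      using \<open>0 < \<alpha>\<close> by auto
    then show ?thesis
      unfolding yosida_def z_def[symmetric] by (auto simp: algebra_simps)
  qed
  finally show ?thesis .
qed

text \<open>
  Monotonicity at the two points \<open>x - \<alpha> u\<close> and \<open>y - \<alpha> v\<close>, with \<open>u\<close> and \<open>v\<close> the Yosida values, gives
  \<open>\<alpha> \<parallel>u - v\<parallel>\<^sup>2 \<le> \<langle>x - y, u - v\<rangle>\<close>, and Cauchy-Schwarz does the rest.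
\<close>

lemma yosida_lipschitz:
  fixes A :: "'b::{real_inner,banach} \<Rightarrow> 'b set"
  assumes A: "maximal_monotone A" and "0 < \<alpha>"
  shows "\<alpha> * norm (yosida \<alpha> A x - yosida \<alpha> A y) \<le> norm (x - y)"
proof -
  define u v where "u = yosida \<alpha> A x" and "v = yosida \<alpha> A y"
  have "u \<in> A (x - \<alpha> *\<^sub>R u)" "v \<in> A (y - \<alpha> *\<^sub>R v)"
    using yosida_eq_iff[OF assms] u_def v_def by blast+
  then have "0 \<le> ((x - \<alpha> *\<^sub>R u) - (y - \<alpha> *\<^sub>R v)) \<bullet> (u - v)"
    using A by (intro monotone_operatorD) (auto simp: maximal_monotone_def)
  also have "\<dots> = (x - y) \<bullet> (u - v) - \<alpha> * (norm (u - v))\<^sup>2"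
    by (simp add: power2_norm_eq_inner inner_simps algebra_simps)
  finally have "\<alpha> * (norm (u - v))\<^sup>2 \<le> norm (x - y) * norm (u - v)"
    using norm_cauchy_schwarz[of "x - y" "u - v"] by linarith
  then have "(\<alpha> * norm (u - v)) * norm (u - v) \<le> norm (x - y) * norm (u - v)"
    by (simp add: power2_eq_square mult.assoc)
  then have "\<alpha> * norm (u - v) \<le> norm (x - y)"
    by (cases "u = v") (auto simp: mult_le_cancel_right)
  then show ?thesis by (simp add: u_def v_def)
qed

section \<open>The composite operator and its resolvent\<close>

lemma monotone_composite_operator:
  fixes C :: "'a::{real_inner,banach} \<Rightarrow> 'b::real_inner"
  assumes C: "bounded_linear C" and "monotone_operator M"
  shows "monotone_operator (composite_operator C M)"
  unfolding monotone_operator_def composite_operator_def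
proof clarify
  fix x y u v assume "u \<in> M (C x)" "v \<in> M (C y)"
  then have "0 \<le> (C x - C y) \<bullet> (u - v)"
    by (rule monotone_operatorD[OF assms(2)])
  also have "\<dots> = (x - y) \<bullet> (adjoint C u - adjoint C v)"
    by (simp add: linear_diff[OF linear_adjoint[OF C], symmetric] inner_adjoint_eq[OF C]
        linear_diff[OF bounded_linear.linear[OF C]])
  finally show "0 \<le> (x - y) \<bullet> (adjoint C u - adjoint C v)" .
qed

lemma mem_resolvent_composite_iff:
  "x \<in> resolvent (scale_operator lam (composite_operator C M)) y \<longleftrightarrow>
     (\<exists>v\<in>M (C x). x = y - lam *\<^sub>R adjoint C v)"
  unfolding mem_resolvent_scale_iff composite_operator_def by (auto simp: algebra_simps)

text \<open>
  The parameter \<open>mu\<close> disappears from the right-hand side: the shift \<open>v/\<mu>\<close> in the argument of the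
  Yosida approximation is undone by the shift \<open>-\<alpha> v\<close> in its characterisation, as \<open>\<alpha> = 1/\<mu>\<close>.
\<close>

lemma fixpoint_map_fixed_iff:
  fixes C :: "'a::{real_inner,banach} \<Rightarrow> 'b::{real_inner,banach}"
  assumes C: "bounded_linear C" and "maximal_monotone M" and "0 < mu"
  shows "fixpoint_map C M lam mu y v = v \<longleftrightarrow> v \<in> M (C (y - lam *\<^sub>R adjoint C v))"
proof -
  have "C (y - lam *\<^sub>R adjoint C v) = C y + ((1 / mu) *\<^sub>R v - lam *\<^sub>R C (adjoint C v)) - (1 / mu) *\<^sub>R v"
    by (simp add: bounded_linear.linear[OF C] linear_diff linear_scale)
  then show ?thesis
    unfolding fixpoint_map_def using yosida_eq_iff[OF assms(2), of "1 / mu"] \<open>0 < mu\<close> by simp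
qed

lemma fixpoint_map_nonexpansive:
  fixes C :: "'a::{real_inner,banach} \<Rightarrow> 'b::{real_inner,banach}"
  assumes C: "bounded_linear C" and "maximal_monotone M" and "0 < mu"
    and contr: "\<And>w. norm (w - (lam * mu) *\<^sub>R C (adjoint C w)) \<le> norm w"
  shows "1-lipschitz_on UNIV (fixpoint_map C M lam mu y)"
proof (rule lipschitz_onI)
  fix v w :: 'b
  define d where "d = v - w"
  have lin: "C (adjoint C d) = C (adjoint C v) - C (adjoint C w)"
    by (simp add: d_def linear_diff linear_adjoint C bounded_linear.linear)
  have "(1 / mu) * norm (fixpoint_map C M lam mu y v - fixpoint_map C M lam mu y w)
      \<le> norm ((1 / mu) *\<^sub>R d - lam *\<^sub>R C (adjoint C d))"
    using yosida_lipschitz[OF assms(2), of "1 / mu" "C y + ((1 / mu) *\<^sub>R v - lam *\<^sub>R C (adjoint C v))"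
        "C y + ((1 / mu) *\<^sub>R w - lam *\<^sub>R C (adjoint C w))"] \<open>0 < mu\<close>
    unfolding fixpoint_map_def lin by (simp add: d_def algebra_simps)
  also have "(1 / mu) *\<^sub>R d - lam *\<^sub>R C (adjoint C d) = (1 / mu) *\<^sub>R (d - (lam * mu) *\<^sub>R C (adjoint C d))"
    using \<open>0 < mu\<close> by (simp add: scaleR_diff_right)
  also have "norm \<dots> \<le> (1 / mu) * norm d"
    using contr[of d] \<open>0 < mu\<close> by (simp add: divide_right_mono)
  finally show "dist (fixpoint_map C M lam mu y v) (fixpoint_map C M lam mu y w) \<le> 1 * dist v w"
    using \<open>0 < mu\<close> by (simp add: dist_norm d_def divide_le_cancel)
qed simp

theorem theorem5:
  fixes C :: "'a::{real_inner,banach} \<Rightarrow> 'b::{real_inner,banach}"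
    and M :: "'b \<Rightarrow> 'b set"
    and lam mu :: real
    and y :: 'a
  assumes "bounded_linear C"
    and "maximal_monotone M"
    and "lam > 0"
    and "mu > 0"
  shows "(resolvent (scale_operator lam (composite_operator C M)) y \<noteq> {} \<longleftrightarrow>
           (\<exists>v. fixpoint_map C M lam mu y v = v)) \<and>
         (\<forall>v. fixpoint_map C M lam mu y v = v \<longrightarrow>
           resolvent (scale_operator lam (composite_operator C M)) y
             = {y - lam *\<^sub>R adjoint C v}) \<and>
         (C = (\<lambda>_. 0) \<or> lam * mu \<le> 2 / (onorm C)\<^sup>2 \<longrightarrow>
           onorm (\<lambda>w. w - (lam * mu) *\<^sub>R C (adjoint C w)) \<le> 1 \<and>
           1-lipschitz_on UNIV (fixpoint_map C M lam mu y))"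
proof -
  let ?R = "resolvent (scale_operator lam (composite_operator C M)) y"
  have mem: "x \<in> ?R \<longleftrightarrow> (\<exists>v. fixpoint_map C M lam mu y v = v \<and> x = y - lam *\<^sub>R adjoint C v)" for x
    unfolding mem_resolvent_composite_iff fixpoint_map_fixed_iff[OF assms(1,2,4)] by auto
  have mono: "monotone_operator (composite_operator C M)"
    using assms by (simp add: monotone_composite_operator maximal_monotone_def)
  have single: "?R = {y - lam *\<^sub>R adjoint C v}" if "fixpoint_map C M lam mu y v = v" for v
  proof -
    have "y - lam *\<^sub>R adjoint C v \<in> ?R"
      using that mem by blast
    then show ?thesis
      using resolvent_scale_unique[OF mono less_imp_le[OF \<open>lam > 0\<close>]] by blast
  qed
  have nonexpansive: "onorm (\<lambda>w. w - (lam * mu) *\<^sub>R C (adjoint C w)) \<le> 1 \<and>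
           1-lipschitz_on UNIV (fixpoint_map C M lam mu y)"
    if small: "C = (\<lambda>_. 0) \<or> lam * mu \<le> 2 / (onorm C)\<^sup>2"
  proof -
    have "lam * mu * (onorm C)\<^sup>2 \<le> 2"
    proof (cases "onorm C = 0")
      case False
      then have "C \<noteq> (\<lambda>_. 0)" by (auto simp: onorm_zero)
      then show ?thesis using small False by (simp add: pos_le_divide_eq)
    qed simp
    then have contr: "norm (w - (lam * mu) *\<^sub>R C (adjoint C w)) \<le> norm w" for w
      using assms by (intro norm_minus_normal_operator_le) auto
    then have "onorm (\<lambda>w. w - (lam * mu) *\<^sub>R C (adjoint C w)) \<le> 1"
      by (intro onorm_bound) simp_all
    then show ?thesis
      using fixpoint_map_nonexpansive[OF assms(1,2,4) contr] by blast
  qed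
  show ?thesis
    using mem single nonexpansive by blast
qed

end
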